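(* Let $R$ be a transit function on a non-empty finite set $V$ that satisfies Axioms (b2), (J2), (J4), (dh1), (TW1') and (TWC). Then $R=T$ on $G_R$, i.e. $R(u,v)=T(u,v)$ for all $u,v\in V$, where $T$ is the toll walk transit function of the underlying graph $G_R$.
   Context: A transit function on a set $V$ is a map $R:V\times V\to 2^V$ such that for all $u,v\in V$: $u\in R(u,v)$, $R(u,v)=R(v,u)$ and $R(u,u)=\{u\}$. The underlying graph $G_R$ has vertex set $V$, and distinct $u,v$ are adjacent iff $R(u,v)=\{u,v\}$. In a finite simple graph $G$, a walk $W=w_1w_2\cdots w_k$ ($k\ge 2$) is a toll walk if $w_1\neq w_k$, $w_2$ is the only neighbor of $w_1$ among the vertices of $W$, and $w_{k-1}$ is the only neighbor of $w_k$ among the vertices of $W$. The toll walk transit function $T$ of $G$ is given by $T(u,u)=\{u\}$ and, for $u\ne v$, $T(u,v)$ is the set of all vertices lying on some toll walk from $u$ to $v$. The axioms (all quantified over elements of $V$): (b2) If $x\in R(u,v)$, then $R(u,x)\subseteq R(u,v)$. (J2) If $R(u,x)=\{u,x\}$, $R(x,v)=\{x,v\}$, $u\neq v$ and $R(u,v)\neq\{u,v\}$, then $x\in R(u,v)$. (J4) If $x\in R(u,y)$, $y\in R(x,v)$, $x\neq y$, $R(u,x)=\{u,x\}$, $R(y,v)=\{y,v\}$ and $R(u,v)\neq\{u,v\}$, then $x\in R(u,v)$. (dh1) If $x\in R(u,y)$, $y\in R(x,v)$, $R(x,y)=\{x,y\}$, $x\neq y$, $R(u,x)\neq\{u,x\}$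 and $R(y,v)\neq\{y,v\}$, then $x\in R(u,v)$. (TW1') If $x,y\in R(u,v)$, $x\neq u$, $y\neq v$, $R(x,v)\neq\{x,v\}$, $R(u,y)\neq\{u,y\}$, $R(x,z)=\{x,z\}$, $R(z,w)=\{z,w\}$, $R(w,y)=\{w,y\}$ and $R(u,w)\neq\{u,w\}$, then $z\in R(u,v)$. (TWC) If $u,v,x$ are pairwise distinct and $x\in R(u,v)$, then there exists $v_1\in R(x,v)$ with $v_1\neq x$, $R(x,v_1)=\{x,v_1\}$, $R(u,v_1)\neq\{u,v_1\}$ and $x\notin R(v_1,v)$.
   Formalization: In a toll walk, w_1 is taken to be adjacent to w_i only for i=2, and w_k to w_i only for i=k-1, so w_2 and w_{k-1} are not revisited; if revisits were allowed, the claim would fail on the star K_{1,3}. *)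

theory Defs
  imports Main
begin

definition transit_function :: "'a set \<Rightarrow> ('a \<Rightarrow> 'a \<Rightarrow> 'a set) \<Rightarrow> bool" where
  "transit_function V R \<longleftrightarrow>
     (\<forall>u\<in>V. \<forall>v\<in>V. R u v \<subseteq> V \<and> u \<in> R u v \<and> R u v = R v u) \<and>
     (\<forall>u\<in>V. R u u = {u})"

text \<open>A simple graph is given by a vertex set \<open>V\<close> and an adjacency relation on \<open>V\<close>
  that is symmetric and irreflexive.\<close>

definition underlying_adj :: "'a set \<Rightarrow> ('a \<Rightarrow> 'a \<Rightarrow> 'a set) \<Rightarrow> 'a \<Rightarrow> 'a \<Rightarrow> bool" where
  "underlying_adj V R u v \<longleftrightarrow> u \<in> V \<and> v \<in> V \<and> u \<noteq> v \<and> R u v = {u, v}"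

lemma underlying_adj_irrefl: "\<not> underlying_adj V R u u"
  by (simp add: underlying_adj_def)

lemma underlying_adj_sym:
  assumes "transit_function V R" and "underlying_adj V R u v"
  shows "underlying_adj V R v u"
  using assms unfolding transit_function_def underlying_adj_def
  by (metis insert_commute)

definition walk :: "'a set \<Rightarrow> ('a \<Rightarrow> 'a \<Rightarrow> bool) \<Rightarrow> 'a list \<Rightarrow> bool" where
  "walk V E W \<longleftrightarrow> W \<noteq> [] \<and> set W \<subseteq> V \<and> successively E W"

text \<open>That \<open>w\<^sub>2\<close> is the only neighbour of \<open>w\<^sub>1\<close> in a walk \<open>w\<^sub>1 w\<^sub>2 \<dots>\<close> refers to positions:
  \<open>w\<^sub>1\<close> is adjacent to \<open>w\<^sub>i\<close> exactly for \<open>i = 2\<close>, so \<open>w\<^sub>2\<close> may not be visited again; likewise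
  at the other end. If only the set of visited vertices counted, then for distinct leaves
  \<open>a\<close>, \<open>b\<close>, \<open>d\<close> of a star with centre \<open>c\<close>, the walk \<open>a c d c b\<close> would be a toll walk. List
  positions start at 0.\<close>

definition toll_walk :: "'a set \<Rightarrow> ('a \<Rightarrow> 'a \<Rightarrow> bool) \<Rightarrow> 'a list \<Rightarrow> bool" where
  "toll_walk V E W \<longleftrightarrow>
     walk V E W \<and> length W \<ge> 2 \<and> hd W \<noteq> last W \<and>
     (\<forall>i<length W. E (hd W) (W ! i) \<longleftrightarrow> i = 1) \<and>
     (\<forall>i<length W. E (last W) (W ! i) \<longleftrightarrow> i = length W - 2)"

definition toll_transit :: "'a set \<Rightarrow> ('a \<Rightarrow> 'a \<Rightarrow> bool) \<Rightarrow> 'a \<Rightarrow> 'a \<Rightarrow> 'a set" where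
  "toll_transit V E u v =
     (if u = v then {u}
      else {x. \<exists>W. toll_walk V E W \<and> hd W = u \<and> last W = v \<and> x \<in> set W})"

text \<open>In the axioms, \<open>R u v = {u, v}\<close> is read literally; for a transit function it also
  holds when \<open>u = v\<close>.\<close>

definition axiom_b2 :: "'a set \<Rightarrow> ('a \<Rightarrow> 'a \<Rightarrow> 'a set) \<Rightarrow> bool" where
  "axiom_b2 V R \<longleftrightarrow>
     (\<forall>u\<in>V. \<forall>v\<in>V. \<forall>x\<in>V. x \<in> R u v \<longrightarrow> R u x \<subseteq> R u v)"

definition axiom_J2 :: "'a set \<Rightarrow> ('a \<Rightarrow> 'a \<Rightarrow> 'a set) \<Rightarrow> bool" where
  "axiom_J2 V R \<longleftrightarrow>
     (\<forall>u\<in>V. \<forall>v\<in>V. \<forall>x\<in>V.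
        R u x = {u, x} \<and> R x v = {x, v} \<and> u \<noteq> v \<and> R u v \<noteq> {u, v} \<longrightarrow> x \<in> R u v)"

definition axiom_J4 :: "'a set \<Rightarrow> ('a \<Rightarrow> 'a \<Rightarrow> 'a set) \<Rightarrow> bool" where
  "axiom_J4 V R \<longleftrightarrow>
     (\<forall>u\<in>V. \<forall>v\<in>V. \<forall>x\<in>V. \<forall>y\<in>V.
        x \<in> R u y \<and> y \<in> R x v \<and> x \<noteq> y \<and>
        R u x = {u, x} \<and> R y v = {y, v} \<and> R u v \<noteq> {u, v} \<longrightarrow> x \<in> R u v)"

definition axiom_dh1 :: "'a set \<Rightarrow> ('a \<Rightarrow> 'a \<Rightarrow> 'a set) \<Rightarrow> bool" where
  "axiom_dh1 V R \<longleftrightarrow>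
     (\<forall>u\<in>V. \<forall>v\<in>V. \<forall>x\<in>V. \<forall>y\<in>V.
        x \<in> R u y \<and> y \<in> R x v \<and> R x y = {x, y} \<and> x \<noteq> y \<and>
        R u x \<noteq> {u, x} \<and> R y v \<noteq> {y, v} \<longrightarrow> x \<in> R u v)"

definition axiom_TW1' :: "'a set \<Rightarrow> ('a \<Rightarrow> 'a \<Rightarrow> 'a set) \<Rightarrow> bool" where
  "axiom_TW1' V R \<longleftrightarrow>
     (\<forall>u\<in>V. \<forall>v\<in>V. \<forall>x\<in>V. \<forall>y\<in>V. \<forall>z\<in>V. \<forall>w\<in>V.
        x \<in> R u v \<and> y \<in> R u v \<and> x \<noteq> u \<and> y \<noteq> v \<and>
        R x v \<noteq> {x, v} \<and> R u y \<noteq> {u, y} \<and>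
        R x z = {x, z} \<and> R z w = {z, w} \<and> R w y = {w, y} \<and>
        R u w \<noteq> {u, w} \<longrightarrow> z \<in> R u v)"

definition axiom_TWC :: "'a set \<Rightarrow> ('a \<Rightarrow> 'a \<Rightarrow> 'a set) \<Rightarrow> bool" where
  "axiom_TWC V R \<longleftrightarrow>
     (\<forall>u\<in>V. \<forall>v\<in>V. \<forall>x\<in>V.
        u \<noteq> v \<and> u \<noteq> x \<and> v \<noteq> x \<and> x \<in> R u v \<longrightarrow>
        (\<exists>v1\<in>R x v. v1 \<noteq> x \<and> R x v1 = {x, v1} \<and> R u v1 \<noteq> {u, v1} \<and> x \<notin> R v1 v))"

end

theory Submission
  imports Defs
begin

text \<open>Put \<open>T\<close> for the toll walk function of \<open>G\<^sub>R\<close>.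

  \<open>R \<subseteq> T\<close>: iterating (TWC) from \<open>x \<in> R u v\<close> gives a walk from \<open>x\<close> to \<open>v\<close> that avoids the
  neighbours of \<open>u\<close> after its first vertex; it ends because (b2) makes the sets \<open>R v\<^sub>i v\<close> strictly
  decreasing. Together with the symmetric walk from \<open>x\<close> to \<open>u\<close>, both cut at the first neighbour of
  their target, this yields a toll walk through \<open>x\<close>.

  \<open>T \<subseteq> R\<close>: by (J2), (J4) and (b2), induced \<open>u\<close>-\<open>v\<close> paths lie in \<open>R u v\<close>. Let \<open>u a \<dots> b v\<close> be a
  toll walk. By (TW1') with \<open>x = w = y\<close>, membership in \<open>R u v\<close> spreads from a vertex strictly
  between \<open>a\<close> and \<open>b\<close> to all its neighbours, so it suffices to find one such vertex in \<open>R u v\<close>.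
  Take a shortest walk \<open>u a \<dots> b v\<close> through the inner vertices. Its only possible chord is \<open>ab\<close>.
  Without that chord it is an induced path; with it, (TW1') settles the case of a single inner
  vertex, and otherwise (dh1) applies to the first two inner vertices.\<close>

text \<open>Turns the positional clause of \<open>toll_walk\<close> at the first vertex into
  conditions on the vertices themselves; the next lemma does so at the last vertex.\<close>

lemma nth_iff_second:
  assumes "\<not> P x" and "P d" and "\<forall>y\<in>set ys. \<not> P y" and "i < length (x # d # ys)"
  shows "P ((x # d # ys) ! i) \<longleftrightarrow> i = 1"
  using assms by (auto simp: nth_Cons split: nat.splits)

lemma nth_iff_second_last:
  assumes "\<not> P x" and "P d" and "\<forall>y\<in>set ys. \<not> P y" and "i < length (ys @ [d, x])"
  shows "P ((ys @ [d, x]) ! i) \<longleftrightarrow> i = length (ys @ [d, x]) - 2"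
proof -
  consider "i < length ys" | "i = length ys" | "i = Suc (length ys)"
    using assms(4) by fastforce
  then show ?thesis
    by cases (use assms in \<open>auto simp: nth_append\<close>)
qed

section \<open>The transit axioms in terms of adjacency\<close>

locale toll_axioms =
  fixes V :: "'a set" and R :: "'a \<Rightarrow> 'a \<Rightarrow> 'a set"
  assumes fin: "finite V"
    and tf: "transit_function V R"
    and b2: "axiom_b2 V R"
    and J2: "axiom_J2 V R"
    and J4: "axiom_J4 V R"
    and dh1: "axiom_dh1 V R"
    and TW1': "axiom_TW1' V R"
    and TWC: "axiom_TWC V R"
begin

abbreviation adj :: "'a \<Rightarrow> 'a \<Rightarrow> bool" where
  "adj \<equiv> underlying_adj V R"

lemma R_sub: "u \<in> V \<Longrightarrow> v \<in> V \<Longrightarrow> R u v \<subseteq> V"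
  and R_left: "u \<in> V \<Longrightarrow> v \<in> V \<Longrightarrow> u \<in> R u v"
  and R_comm: "u \<in> V \<Longrightarrow> v \<in> V \<Longrightarrow> R u v = R v u"
  and R_refl: "u \<in> V \<Longrightarrow> R u u = {u}"
  using tf unfolding transit_function_def by blast+

lemma R_right: "u \<in> V \<Longrightarrow> v \<in> V \<Longrightarrow> v \<in> R u v"
  using R_left R_comm by blast

lemma adj_sym: "adj u v \<Longrightarrow> adj v u"
  by (rule underlying_adj_sym[OF tf])

lemma adjD: "adj u v \<Longrightarrow> u \<in> V \<and> v \<in> V \<and> u \<noteq> v \<and> R u v = {u, v}"
  by (simp add: underlying_adj_def)

text \<open>The literal equation includes the case \<open>u = v\<close>, so each negated equation in
  an axiom demands distinctness as well as non-adjacency.\<close>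

lemma R_eq_pair_iff:
  "u \<in> V \<Longrightarrow> v \<in> V \<Longrightarrow> R u v = {u, v} \<longleftrightarrow> u = v \<or> adj u v"
  by (auto simp: underlying_adj_def R_refl)

lemma R_mono_right: "u \<in> V \<Longrightarrow> v \<in> V \<Longrightarrow> x \<in> R u v \<Longrightarrow> R u x \<subseteq> R u v"
  using b2 R_sub unfolding axiom_b2_def by blast

lemma R_mono_left: "u \<in> V \<Longrightarrow> v \<in> V \<Longrightarrow> x \<in> R u v \<Longrightarrow> R x v \<subseteq> R u v"
  using R_mono_right[of v u x] R_comm[of u v] R_comm[of x v] R_sub[of u v] by blast

lemma J2_adj:
  assumes "adj u x" "adj x v" "u \<noteq> v" "\<not> adj u v"
  shows "x \<in> R u v"
  using assms J2 adjD[of u x] adjD[of x v] R_eq_pair_iff[of u v]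
  unfolding axiom_J2_def by blast

lemma J4_adj:
  assumes "x \<in> R u y" "y \<in> R x v" "x \<noteq> y" "adj u x" "adj y v" "u \<noteq> v" "\<not> adj u v"
  shows "x \<in> R u v"
  using assms J4 adjD[of u x] adjD[of y v] R_eq_pair_iff[of u v]
  unfolding axiom_J4_def by blast

lemma dh1_adj:
  assumes "x \<in> R u y" "y \<in> R x v" "adj x y" "u \<in> V" "v \<in> V"
    "u \<noteq> x" "\<not> adj u x" "y \<noteq> v" "\<not> adj y v"
  shows "x \<in> R u v"
  using assms dh1 adjD[of x y] R_eq_pair_iff[of u x] R_eq_pair_iff[of y v]
  unfolding axiom_dh1_def by blast

text \<open>The instance \<open>w = y\<close> of (TW1'): since \<open>R y y = {y, y}\<close>, the
  path \<open>x z w y\<close> collapses to \<open>x z y\<close>.\<close>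

lemma TW1'_common_neighbour:
  assumes "x \<in> R u v" "y \<in> R u v" "u \<in> V" "v \<in> V" "x \<noteq> u" "y \<noteq> v" "x \<noteq> v" "y \<noteq> u"
    "\<not> adj x v" "\<not> adj u y" "adj x z" "adj z y"
  shows "z \<in> R u v"
proof -
  have V: "x \<in> V" "y \<in> V" "z \<in> V" using assms(11,12) adjD by blast+
  have "R x v \<noteq> {x, v}" "R u y \<noteq> {u, y}" "R x z = {x, z}" "R z y = {z, y}" "R y y = {y, y}"
    using assms V by (simp_all add: R_eq_pair_iff R_refl)
  then show ?thesis
    using TW1' assms(1-6) V unfolding axiom_TW1'_def by blast
qed

subsection \<open>From \<open>R\<close> to toll walks\<close>

text \<open>The head is exempt from the condition on \<open>u\<close> because \<open>x\<close>
  itself may be adjacent to \<open>u\<close>; the opposite chain, from \<open>x\<close> to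
  \<open>u\<close>, then consists of \<open>x\<close> alone.\<close>

lemma TWC_chain:
  assumes "u \<in> V" "v \<in> V" "u \<noteq> v" "x \<in> R u v" "x \<noteq> u" "x \<noteq> v"
  shows "\<exists>B. B \<noteq> [] \<and> hd B = x \<and> set B \<subseteq> V \<and> successively adj B \<and> adj (last B) v \<and>
    (\<forall>y\<in>set (butlast B). \<not> adj v y) \<and> (\<forall>y\<in>set (tl B). \<not> adj u y)"
  using assms(4-6)
proof (induction "card (R x v)" arbitrary: x rule: less_induct)
  case less
  have xV: "x \<in> V" using R_sub less.prems assms by blast
  show ?case
  proof (cases "adj x v")
    case True
    then show ?thesis using xV by (intro exI[of _ "[x]"]) simp
  next
    case False
    obtain v1 where v1: "v1 \<in> R x v" "v1 \<noteq> x" "R x v1 = {x, v1}" "R u v1 \<noteq> {u, v1}"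
        "x \<notin> R v1 v"
      using TWC[unfolded axiom_TWC_def, rule_format, OF assms(1,2) xV] assms(3) less.prems by auto
    have v1V: "v1 \<in> V" using v1(1) R_sub xV assms by blast
    have xv1: "adj x v1" using v1 xV v1V by (simp add: underlying_adj_def)
    have nu: "v1 \<noteq> u" "\<not> adj u v1" using v1(4) R_eq_pair_iff[OF assms(1) v1V] by blast+
    have xnu: "\<not> adj v x" using False adj_sym by blast
    \<comment> \<open>Inclusion is (b2); it is strict because (TWC) keeps \<open>x\<close> out of
      \<open>R v1 v\<close>. This is the termination measure.\<close>
    have "R v1 v \<subset> R x v"
      using R_mono_left[OF xV assms(2) v1(1)] v1(5) R_left[OF xV assms(2)] by blast
    then have "card (R v1 v) < card (R x v)"
      using R_sub[OF xV assms(2)] fin by (meson finite_subset psubset_card_mono)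
    moreover have "v1 \<in> R u v"
      using R_mono_left[OF assms(1,2) less.prems(1)] v1(1) by blast
    moreover have "v1 \<noteq> v" using False xv1 by blast
    ultimately obtain B where B: "B \<noteq> []" "hd B = v1" "set B \<subseteq> V" "successively adj B"
        "adj (last B) v" "\<forall>y\<in>set (butlast B). \<not> adj v y" "\<forall>y\<in>set (tl B). \<not> adj u y"
      using less.hyps nu(1) by blast
    have "\<forall>y\<in>set B. \<not> adj u y" using B(1,2,7) nu(2) by (cases B) auto
    then show ?thesis
      using B xV xv1 xnu by (intro exI[of _ "x # B"]) (auto simp: successively_Cons)
  qed
qed

lemma toll_walk_through:
  assumes "u \<in> V" "v \<in> V" "u \<noteq> v" "x \<in> R u v" "x \<noteq> u" "x \<noteq> v"
  shows "\<exists>W. toll_walk V adj W \<and> hd W = u \<and> last W = v \<and> x \<in> set W"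
proof -
  have nuv: "\<not> adj u v" using assms adjD by blast
  obtain B where B: "B \<noteq> []" "hd B = x" "set B \<subseteq> V" "successively adj B" "adj (last B) v"
      "\<forall>y\<in>set (butlast B). \<not> adj v y" "\<forall>y\<in>set (tl B). \<not> adj u y"
    using TWC_chain[OF assms] by blast
  have "x \<in> R v u" using assms R_comm by blast
  then obtain C where C: "C \<noteq> []" "hd C = x" "set C \<subseteq> V" "successively adj C" "adj (last C) u"
      "\<forall>y\<in>set (butlast C). \<not> adj u y" "\<forall>y\<in>set (tl C). \<not> adj v y"
    using TWC_chain[of v u x] assms by blast
  \<comment> \<open>\<open>C\<close> leads from \<open>x\<close> to a neighbour of \<open>u\<close>,
    so it is reversed; \<open>tl B\<close> avoids listing the junction \<open>x\<close>
    twice.\<close>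
  define W where "W = u # rev C @ tl B @ [v]"
  have rC: "rev C = last C # rev (butlast C)"
    using C(1) by (metis append_butlast_last_id rev_eq_Cons_iff rev_rev_ident)
  \<comment> \<open>Two further decompositions of \<open>W\<close>: \<open>W1\<close> isolates the
    neighbour of \<open>u\<close>, \<open>W2\<close> that of \<open>v\<close>. The remaining
    vertices are non-adjacent to the respective end by the two clauses on \<open>butlast\<close> and
    \<open>tl\<close>.\<close>
  have W1: "W = u # last C # (rev (butlast C) @ tl B @ [v])"
    by (simp add: W_def rC)
  have "rev C @ tl B = rev (tl C) @ B"
    using B(1,2) C(1,2) by (cases B; cases C) auto
  also have "\<dots> = rev (tl C) @ butlast B @ [last B]" using B(1) by simp
  finally have W2: "W = (u # rev (tl C) @ butlast B) @ [last B, v]"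
    by (simp add: W_def)
  have xs: "x \<in> set W" using C(1,2) by (auto simp: W_def)
  have "successively (\<lambda>x y. adj y x) C"
    using C(4) by (rule successively_mono) (rule adj_sym)
  then have "successively adj (rev C)" by (simp add: successively_rev)
  moreover have "successively adj (x # tl B @ [v])"
  proof -
    have "x # tl B @ [v] = B @ [v]" using B(1,2) by (cases B) auto
    moreover have "successively adj (B @ [v])" using B(1,4,5) by (simp add: successively_append_iff)
    ultimately show ?thesis by (simp only:)
  qed
  moreover have "last (rev C) = x" using C(1,2) by (simp add: last_rev)
  moreover have "adj u (hd (rev C))" using C(1) adj_sym[OF C(5)] by (simp add: hd_rev)
  ultimately have "successively adj W"
    using C(1) unfolding W_def by (simp add: successively_append_iff successively_Cons)
  moreover have "set W \<subseteq> V"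
    using assms B(1,3) C(3) by (auto simp: W_def dest: list.set_sel(2))
  ultimately have "walk V adj W" by (simp add: walk_def W_def)
  moreover have "adj (hd W) (W ! i) \<longleftrightarrow> i = 1" if "i < length W" for i
  proof -
    have "adj u (W ! i) \<longleftrightarrow> i = 1"
      using that unfolding W1
      by (intro nth_iff_second)
        (use B(7) C(5,6) nuv adj_sym[OF C(5)] in \<open>auto simp: underlying_adj_irrefl\<close>)
    then show ?thesis by (simp add: W_def)
  qed
  moreover have "adj (last W) (W ! i) \<longleftrightarrow> i = length W - 2" if "i < length W" for i
  proof -
    have "adj v (W ! i) \<longleftrightarrow> i = length W - 2"
      using that unfolding W2
      by (intro nth_iff_second_last)
        (use B(5,6) C(7) nuv adj_sym[of v u] adj_sym[OF B(5)] in \<open>auto simp: underlying_adj_irrefl\<close>)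
    then show ?thesis by (simp add: W_def)
  qed
  ultimately have "toll_walk V adj W" using assms(3) by (simp add: toll_walk_def W_def)
  then show ?thesis using xs by (intro exI[of _ W]) (simp add: W_def)
qed

lemma R_subset_toll_transit:
  assumes "u \<in> V" "v \<in> V"
  shows "R u v \<subseteq> toll_transit V adj u v"
proof (cases "u = v")
  case True
  then show ?thesis using assms by (simp add: toll_transit_def R_refl)
next
  case False
  \<comment> \<open>The ends \<open>u\<close> and \<open>v\<close> belong to
    \<open>toll_transit\<close> only if some toll walk joins them, hence this separate existence
    claim.\<close>
  have "\<exists>W. toll_walk V adj W \<and> hd W = u \<and> last W = v"
  proof (cases "adj u v")
    case True
    then have "adj v u" by (rule adj_sym)
    with True False assms have "toll_walk V adj [u, v]"
      by (simp add: toll_walk_def walk_def underlying_adj_irrefl less_Suc_eq all_conj_distrib)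
    then show ?thesis by (intro exI[of _ "[u, v]"]) simp
  next
    case F: False
    then obtain x where "x \<in> R u v" "x \<noteq> u" "x \<noteq> v"
      using R_eq_pair_iff[OF assms] R_left[OF assms] R_right[OF assms] False by blast
    then show ?thesis using toll_walk_through assms False by blast
  qed
  then obtain W where W: "toll_walk V adj W" "hd W = u" "last W = v" by blast
  then have "u \<in> set W" "v \<in> set W" by (auto simp: toll_walk_def walk_def)
  with W have ends: "u \<in> toll_transit V adj u v" "v \<in> toll_transit V adj u v"
    using False by (auto simp: toll_transit_def)
  show ?thesis
  proof
    fix x assume "x \<in> R u v"
    then show "x \<in> toll_transit V adj u v"
      using ends toll_walk_through[OF assms False, of x] False
      by (cases "x = u \<or> x = v") (auto simp: toll_transit_def)
  qed
qed

subsection \<open>From toll walks to \<open>R\<close>\<close>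

text \<open>Induction on the length: once \<open>p (h - 1)\<close> is in
  \<open>R (p l) (p h)\<close>, (b2) reduces the other vertices to the path without
  \<open>p h\<close>. Keeping \<open>p\<close> fixed and varying the bounds avoids reindexing
  subpaths.\<close>

lemma induced_path_in_R:
  assumes "\<forall>i. l \<le> i \<and> i \<le> h \<longrightarrow> p i \<in> V"
    and "\<forall>i j. l \<le> i \<and> i < j \<and> j \<le> h \<longrightarrow> p i \<noteq> p j \<and> (adj (p i) (p j) \<longleftrightarrow> j = Suc i)"
    and "l \<le> k" "k \<le> h"
  shows "p k \<in> R (p l) (p h)"
  using assms
proof (induction "h - l" arbitrary: l h k rule: less_induct)
  case less
  have V: "p i \<in> V" if "l \<le> i" "i \<le> h" for i using less.prems(1) that by blast
  have ne: "p i \<noteq> p j" and ad: "adj (p i) (p j) \<longleftrightarrow> j = Suc i" if "l \<le> i" "i < j" "j \<le> h" for i j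
    using less.prems(2) that by blast+
  have IH: "p k \<in> R (p l') (p h')" if "h' - l' < h - l" "l \<le> l'" "h' \<le> h" "l' \<le> k" "k \<le> h'" for l' h' k
    by (rule less.hyps) (use that less.prems(1,2) in auto)
  consider "k = l" | "k = h" | "l < k" "k < h" using less.prems(3,4) by linarith
  then show ?case
  proof cases
    case 1 then show ?thesis using R_left V less.prems by auto
  next
    case 2 then show ?thesis using R_right V less.prems by auto
  next
    case 3
    have "p (h - 1) \<in> R (p h) (p l)"
    \<comment> \<open>On a path with two edges, \<open>p (h - 1)\<close> and
      \<open>p (Suc l)\<close> coincide, which (J4) excludes; (J2) covers this case.\<close>
    proof (cases "h = Suc (Suc l)")
      case True
      then show ?thesis
        using 3 ne[of l h] ad[of l h] ad[of l "Suc l"] ad[of "Suc l" h]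
          J2_adj[of "p h" "p (h - 1)" "p l"] adj_sym
        by auto
    next
      case False
      then have lt: "l < h" "h \<noteq> Suc l" "Suc l < h - 1" using 3 by linarith+
      have "p (h - 1) \<in> R (p (Suc l)) (p h)" "p (Suc l) \<in> R (p l) (p (h - 1))"
        by (rule IH; use lt in auto)+
      then have "p (h - 1) \<in> R (p h) (p (Suc l))" "p (Suc l) \<in> R (p (h - 1)) (p l)"
        using R_comm V lt by auto
      moreover have "p (h - 1) \<noteq> p (Suc l)" "adj (p h) (p (h - 1))" "adj (p (Suc l)) (p l)"
        "p h \<noteq> p l" "\<not> adj (p h) (p l)"
        using lt ne[of "Suc l" "h - 1"] ad[of "h - 1" h] ad[of l "Suc l"] ne[of l h] ad[of l h]
          adj_sym[of "p (h - 1)" "p h"] adj_sym[of "p l" "p (Suc l)"] adj_sym[of "p h" "p l"]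
        by auto
      ultimately show ?thesis by (rule J4_adj)
    qed
    then have "p (h - 1) \<in> R (p l) (p h)" using R_comm V 3 by auto
    then have "R (p l) (p (h - 1)) \<subseteq> R (p l) (p h)" using R_mono_right V 3 by auto
    moreover have "p k \<in> R (p l) (p (h - 1))" by (rule IH) (use 3 in auto)
    ultimately show ?thesis by blast
  qed
qed

text \<open>Here \<open>s\<close> plays both \<open>x\<close> and \<open>y\<close> in (TW1').
  Nothing else is asked of \<open>z\<close>, so it may be a neighbour of \<open>u\<close> or
  \<open>v\<close>.\<close>

lemma neighbour_in_R:
  assumes "u \<in> V" "v \<in> V" "s \<in> R u v" "s \<noteq> u" "s \<noteq> v" "\<not> adj u s" "\<not> adj v s" "adj s z"
  shows "z \<in> R u v"
  using TW1'_common_neighbour[of s u v s z] assms adj_sym by blast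

text \<open>\<open>n\<close> is the position just before \<open>v\<close>, and
  \<open>3 \<le> n\<close> forces at least one vertex from \<open>S\<close>. Repetitions and chords
  are permitted; minimality of \<open>n\<close> restricts them later.\<close>

definition walk_via :: "'a \<Rightarrow> 'a \<Rightarrow> 'a set \<Rightarrow> 'a \<Rightarrow> 'a \<Rightarrow> nat \<Rightarrow> (nat \<Rightarrow> 'a) \<Rightarrow> bool" where
  "walk_via u a S b v n p \<longleftrightarrow> 3 \<le> n \<and> p 0 = u \<and> p 1 = a \<and> p n = b \<and> p (Suc n) = v \<and>
     (\<forall>i. 2 \<le> i \<and> i < n \<longrightarrow> p i \<in> S) \<and> (\<forall>i\<le>n. adj (p i) (p (Suc i)))"

text \<open>Positions \<open>i + 1\<close> to \<open>i + d\<close> are deleted. The disjunction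
  rules out jumping from \<open>a\<close> straight to \<open>b\<close>, so a vertex from
  \<open>S\<close> survives.\<close>

lemma walk_via_shortcut:
  assumes "walk_via u a S b v n p" and "1 \<le> i" "i + d < n" "2 \<le> i \<or> i + d < n - 1" "0 < d"
    and "adj (p i) (p (Suc i + d))"
  shows "walk_via u a S b v (n - d) (\<lambda>k. if k \<le> i then p k else p (k + d))"
proof -
  let ?q = "\<lambda>k. if k \<le> i then p k else p (k + d)"
  have "adj (?q k) (?q (Suc k))" if "k \<le> n - d" for k
  proof -
    consider "k < i" | "k = i" | "i < k" by linarith
    then show ?thesis
      by cases (use assms that in \<open>auto simp: walk_via_def\<close>)
  qed
  then show ?thesis using assms unfolding walk_via_def by auto
qed

lemma walk_via_meets_R:
  assumes ex: "\<exists>n p. walk_via u a S b v n p"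
    and S: "\<forall>s\<in>S. s \<noteq> u \<and> s \<noteq> v \<and> \<not> adj u s \<and> \<not> adj v s"
    and uv: "u \<noteq> v" "\<not> adj u v" and av: "a \<noteq> v" "\<not> adj a v" and ub: "u \<noteq> b" "\<not> adj u b"
  shows "\<exists>s\<in>S. s \<in> R u v"
proof -
  define n where "n = (LEAST n. \<exists>p. walk_via u a S b v n p)"
  obtain p where p: "walk_via u a S b v n p"
    using LeastI_ex[OF ex] unfolding n_def by blast
  have least: "\<not> walk_via u a S b v m q" if "m < n" for m q
    using not_less_Least[of m "\<lambda>n. \<exists>p. walk_via u a S b v n p"] that unfolding n_def by blast
  have n3: "3 \<le> n" and p0: "p 0 = u" and p1: "p 1 = a" and pn: "p n = b" and pv: "p (Suc n) = v"
    and pS: "\<And>i. 2 \<le> i \<Longrightarrow> i < n \<Longrightarrow> p i \<in> S" and padj: "\<And>i. i \<le> n \<Longrightarrow> adj (p i) (p (Suc i))"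
    using p unfolding walk_via_def by auto
  have V: "p i \<in> V" if "i \<le> Suc n" for i
    using that padj[of i] padj[of n] adjD by (cases "i = Suc n") (auto simp: le_Suc_eq)
  have uV: "u \<in> V" and vV: "v \<in> V" using V p0 pv by force+
  have no_chord: "\<not> adj (p i) (p j)" if "1 \<le> i" "Suc i < j" "j \<le> n" "i \<noteq> 1 \<or> j \<noteq> n" for i j
  proof
    assume "adj (p i) (p j)"
    then have "walk_via u a S b v (n - (j - Suc i)) (\<lambda>k. if k \<le> i then p k else p (k + (j - Suc i)))"
      by (intro walk_via_shortcut[OF p]) (use that in auto)
    then show False using least that by force
  qed
  have u_nth: "p i \<noteq> u \<and> \<not> adj u (p i)" if i: "2 \<le> i" "i \<le> Suc n" for i
  proof -
    consider "i < n" | "i = n" | "i = Suc n" using i by linarith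
    then show ?thesis using S pS[of i] i uv ub pn pv by cases auto
  qed
  have v_nth: "p i \<noteq> v \<and> \<not> adj (p i) v" if i: "i < n" for i
  proof -
    consider "i = 0" | "i = 1" | "2 \<le> i" by linarith
    then show ?thesis using S pS[of i] i uv av p0 p1 adj_sym by cases auto
  qed
  have ne: "p i \<noteq> p j" if ij: "i < j" "j \<le> Suc n" for i j
  proof
    assume eq: "p i = p j"
    consider "i = 0" | "i = 1" | "j = Suc n" | "j = n" "2 \<le> i" | "2 \<le> i" "j < n"
      using ij by linarith
    then show False
    proof cases
      case 1
      then show False
        using u_nth[of j] eq p0 padj[of 0] adjD[of "p 0" "p 1"] ij by (cases "j = 1") auto
    next
      case 2
      then show False using u_nth[of j] eq p0 padj[of 0] ij by auto
    next
      case 3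
      have "i \<noteq> n" using 3 eq padj[of n] underlying_adj_irrefl by fastforce
      then have "i < n" using 3 ij by simp
      then show False using v_nth[of i] eq pv 3 by simp
    next
      case 4
      then show False using v_nth[of i] eq pv padj[of n] ij by auto
    next
      case 5
      \<comment> \<open>The loop from position \<open>i\<close> to \<open>j\<close> is cut out: the
        edge leaving \<open>p j\<close> also leaves \<open>p i\<close>.\<close>
      then have "adj (p i) (p (Suc i + (j - i)))" using padj[of j] eq ij by simp
      then have "walk_via u a S b v (n - (j - i)) (\<lambda>k. if k \<le> i then p k else p (k + (j - i)))"
        by (intro walk_via_shortcut[OF p]) (use ij 5 in auto)
      then show False using least ij n3 by force
    qed
  qed
  have ad: "adj (p i) (p j) \<longleftrightarrow> j = Suc i" if ij: "i < j" "j \<le> Suc n" "i \<noteq> 1 \<or> j \<noteq> n" for i j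
  proof (cases "j = Suc i")
    case True
    then show ?thesis using padj ij by simp
  next
    case False
    then consider "i = 0" | "j = Suc n" | "1 \<le> i" "j \<le> n" using ij by linarith
    then have "\<not> adj (p i) (p j)"
      by cases (use False ij u_nth[of j] p0 v_nth[of i] pv no_chord[of i j] in auto)
    then show ?thesis using False by blast
  qed
  show ?thesis
  proof (cases "adj a b")
    case False
    have "p 2 \<in> R (p 0) (p (Suc n))"
    proof (rule induced_path_in_R)
      have "adj (p 1) (p n) \<longleftrightarrow> n = Suc 1" using False p1 pn n3 by auto
      then have "adj (p i) (p j) \<longleftrightarrow> j = Suc i" if "i < j" "j \<le> Suc n" for i j
        using ad[OF that] by blast
      with ne show "\<forall>i j. 0 \<le> i \<and> i < j \<and> j \<le> Suc n \<longrightarrow> p i \<noteq> p j \<and> (adj (p i) (p j) \<longleftrightarrow> j = Suc i)"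
        by blast
    qed (use V n3 in auto)
    then show ?thesis using pS[of 2] p0 pv n3 by auto
  next
    case ab: True
    show ?thesis
    proof (cases "n = 3")
      case True
      \<comment> \<open>\<open>u a b v\<close> is an induced path, so (J2) and (J4) place
        \<open>a\<close> and \<open>b\<close> in \<open>R u v\<close>; \<open>p 2\<close> is their
        common neighbour.\<close>
      have ua: "adj u a" and bv: "adj b v" using padj[of 0] padj[of n] p0 p1 pn pv by auto
      have "a \<in> R u b" using J2_adj ua ab ub by blast
      moreover have "b \<in> R a v" using J2_adj ab bv av by blast
      moreover have "a \<noteq> b" using ab adjD by blast
      ultimately have "a \<in> R u v" "b \<in> R v u"
        using J4_adj[of a u b v] J4_adj[of b v a u] ua bv uv adj_sym[of u a] adj_sym[of b v]
          adj_sym[of v u] R_comm[of u b] R_comm[of a v] adjD[OF ab] uV vV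
        by auto
      then have "a \<in> R u v" "b \<in> R u v" using R_comm[OF uV vV] by auto
      then have "p 2 \<in> R u v"
        using TW1'_common_neighbour[of a u v b "p 2"] padj[of 1] padj[of 2] p1 pn True uV vV av ub
          adjD[OF adj_sym[OF ua]] adjD[OF bv]
        by (simp add: numeral_2_eq_2 numeral_3_eq_3)
      then show ?thesis using pS[of 2] True by auto
    next
      case False
      \<comment> \<open>As \<open>n\<close> is at least 4, neither the positions 0 to 3 nor those
        from 2 to \<open>n + 1\<close> contain both ends of the chord \<open>ab\<close>. Both
        segments are induced and overlap in the edge used by (dh1).\<close>
      have "p 2 \<in> R (p 0) (p 3)"
        by (rule induced_path_in_R) (use V ne ad n3 False in auto)
      moreover have "p 3 \<in> R (p 2) (p (Suc n))"
        by (rule induced_path_in_R) (use V ne ad n3 False in auto)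
      moreover have "adj (p 2) (p 3)" using padj[of 2] n3 by simp
      ultimately have "p 2 \<in> R u v"
        using dh1_adj[of "p 2" u "p 3" v] p0 pv uV vV u_nth[of 2] v_nth[of 3] n3 False by auto
      then show ?thesis using pS[of 2] n3 by auto
    qed
  qed
qed

section \<open>Membership of all vertices of a toll walk\<close>

lemma toll_walk_in_R:
  assumes W: "toll_walk V adj W" and x: "x \<in> set W"
  shows "x \<in> R (hd W) (last W)"
proof -
  define u v where "u = hd W" and "v = last W"
  define n where "n = length W - 2"
  have len: "length W = n + 2" and Wne: "W \<noteq> []" using W by (auto simp: toll_walk_def n_def)
  have W0: "W ! 0 = u" and Wv: "W ! Suc n = v"
    using Wne len by (simp_all add: u_def v_def hd_conv_nth last_conv_nth)
  have VW: "W ! i \<in> V" if "i \<le> Suc n" for i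
    using W that len unfolding toll_walk_def walk_def by (auto simp: subset_iff)
  have uV: "u \<in> V" and vV: "v \<in> V" using VW W0 Wv by force+
  have Wadj: "adj (W ! i) (W ! Suc i)" if "i \<le> n" for i
    using W that len unfolding toll_walk_def walk_def by (auto simp: successively_conv_nth)
  have uW: "adj u (W ! i) \<longleftrightarrow> i = 1" and vW: "adj v (W ! i) \<longleftrightarrow> i = n" if "i \<le> Suc n" for i
    using W that len unfolding toll_walk_def u_def v_def by auto
  have uv: "u \<noteq> v" using W unfolding toll_walk_def u_def v_def by blast
  have "W ! k \<in> R u v" if k: "k \<le> Suc n" for k
  proof (cases "k = 0 \<or> k = Suc n")
    case True
    then show ?thesis using W0 Wv R_left R_right uV vV by auto
  next
    case False
    then have k: "1 \<le> k" "k \<le> n" using k by auto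
    have nuv: "\<not> adj u v" using uW[of "Suc n"] Wv k by auto
    have ua: "adj u (W ! 1)" and bv: "adj (W ! n) v" using uW[of 1] vW[of n] k adj_sym by auto
    consider "n = 1" | "n = 2" | "3 \<le> n" using k by linarith
    then show ?thesis
    proof cases
      case 1
      then show ?thesis using J2_adj ua bv uv nuv k by auto
    next
      case 2
      have "adj (W ! 1) (W ! 2)" using Wadj[of 1] 2 by (simp add: numeral_2_eq_2)
      moreover have "\<not> adj u (W ! 2)" "\<not> adj (W ! 1) v" using uW[of 2] vW[of 1] 2 adj_sym by auto
      ultimately have "W ! 1 \<in> R u (W ! 2)" "W ! 2 \<in> R (W ! 1) v" "W ! 1 \<noteq> W ! 2"
        using J2_adj[of u "W ! 1" "W ! 2"] J2_adj[of "W ! 1" "W ! 2" v] ua bv nuv 2 adjD adj_sym by metis+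
      then have "W ! 1 \<in> R u v" "W ! 2 \<in> R v u"
        using J4_adj[of "W ! 1" u "W ! 2" v] J4_adj[of "W ! 2" v "W ! 1" u] ua bv uv nuv 2 VW R_comm uV vV
          adj_sym[of v u] adj_sym[of u "W ! 1"] adj_sym[of "W ! 2" v]
        by auto
      moreover have "k = 1 \<or> k = 2" using k 2 by linarith
      ultimately show ?thesis using R_comm uV vV by auto
    next
      case 3
      define S where "S = (\<lambda>i. W ! i) ` {2..<n}"
      have S: "s \<noteq> u \<and> s \<noteq> v \<and> \<not> adj u s \<and> \<not> adj v s" if s: "s \<in> S" for s
      proof -
        obtain i where i: "s = W ! i" "2 \<le> i" "i < n" using s by (auto simp: S_def)
        \<comment> \<open>If \<open>s\<close> were \<open>u\<close>, the vertex after it would be a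
          second neighbour of \<open>u\<close>; if it were \<open>v\<close>, the vertex before it
          would be a second neighbour of \<open>v\<close>.\<close>
        have "s \<noteq> u" using Wadj[of i] uW[of "Suc i"] i by auto
        moreover have "s \<noteq> v" using Wadj[of "i - 1"] vW[of "i - 1"] i adj_sym[of "W ! (i - 1)" "W ! i"] by force
        ultimately show ?thesis using uW[of i] vW[of i] i by auto
      qed
      have "walk_via u (W ! 1) S (W ! n) v n (\<lambda>i. W ! i)"
        using 3 W0 Wv Wadj by (auto simp: walk_via_def S_def)
      moreover have "W ! 1 \<noteq> v" "\<not> adj (W ! 1) v" "u \<noteq> W ! n" "\<not> adj u (W ! n)"
        using ua bv nuv uW[of n] vW[of 1] 3 adj_sym by auto
      ultimately obtain s where "s \<in> S" "s \<in> R u v"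
        using walk_via_meets_R S uv nuv by blast
      then obtain i where i: "W ! i \<in> R u v" "2 \<le> i" "i < n" by (auto simp: S_def)
      \<comment> \<open>Only positions 2 to \<open>n - 1\<close> serve as sources, but targets
        include \<open>W ! 1\<close> and \<open>W ! n\<close>, so moving up and down from
        \<open>i\<close> reaches every remaining position.\<close>
      have spread: "z \<in> R u v" if "W ! j \<in> R u v" "2 \<le> j" "j < n" "adj (W ! j) z" for j z
        using neighbour_in_R[OF uV vV that(1)] S[of "W ! j"] that by (auto simp: S_def)
      show ?thesis
      proof (cases "i \<le> k")
        case True
        then show ?thesis using k(2)
        proof (induction k rule: dec_induct)
          case base then show ?case using i by simp
        next
          case (step j) then show ?case using spread[of j "W ! Suc j"] Wadj[of j] i by simp
        qed
      next
        case False
        then have "k \<le> i" by simp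
        then show ?thesis using k(1)
        proof (induction k rule: inc_induct)
          case base then show ?case using i by simp
        next
          case (step j)
          then show ?case using spread[of "Suc j" "W ! j"] Wadj[of j] i adj_sym by simp
        qed
      qed
    qed
  qed
  moreover obtain k where "k < length W" "x = W ! k" using x by (metis in_set_conv_nth)
  ultimately show ?thesis using len by (simp add: u_def v_def)
qed

lemma R_eq_toll_transit:
  assumes "u \<in> V" "v \<in> V"
  shows "R u v = toll_transit V adj u v"
proof
  show "toll_transit V adj u v \<subseteq> R u v"
    using toll_walk_in_R assms by (auto simp: toll_transit_def R_refl)
qed (rule R_subset_toll_transit[OF assms])

end

theorem theorem14:
  fixes V :: "'a set" and R :: "'a \<Rightarrow> 'a \<Rightarrow> 'a set"
  assumes "finite V" and "V \<noteq> {}"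
    and "transit_function V R"
    and "axiom_b2 V R"
    and "axiom_J2 V R"
    and "axiom_J4 V R"
    and "axiom_dh1 V R"
    and "axiom_TW1' V R"
    and "axiom_TWC V R"
  shows "\<forall>u\<in>V. \<forall>v\<in>V. R u v = toll_transit V (underlying_adj V R) u v"
proof -
  interpret toll_axioms V R using assms by unfold_locales
  show ?thesis using R_eq_toll_transit by blast
qed

end
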